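(* Let $\tau>0$, $\lambda\in[0,1]$, and let $(\phi^n,r^n)$ and $(\phi^{n+1},\mu^{n+1},r^{n+1})$ satisfy the first-order weighted SAV-BE scheme $$\frac{\phi^{n+1}-\phi^{n}}{\tau}=-\mathcal{G}\mu^{n+1},$$ $$\mu^{n+1}=\mathcal{L}\phi^{n+1}+\frac{r^{n+1}}{\sqrt{\mathcal{E}_{\mathcal N}[\phi^{n}]+C}}H(\phi^{n}),$$ $$2\lambda r^{n+1}\,\frac{r^{n+1}-r^{n}}{\tau}+(1-\lambda)\frac{\mathcal{E}_{\mathcal N}[\phi^{n+1}]-\mathcal{E}_{\mathcal N}[\phi^{n}]}{\tau}=\frac{r^{n+1}}{\sqrt{\mathcal{E}_{\mathcal N}[\phi^{n}]+C}}\left(H(\phi^{n}),\frac{\phi^{n+1}-\phi^{n}}{\tau}\right).$$ Then, unconditionally (with no restriction on $\tau$), $$\frac{\overline{\mathcal{E}}[\phi^{n+1},r^{n+1}]-\overline{\mathcal{E}}[\phi^{n},r^{n}]}{\tau}\le-(\mu^{n+1},\mathcal{G}\mu^{n+1})\le 0,$$ where $$\overline{\mathcal{E}}[\phi^{n},r^{n}]=\frac12(\phi^{n},\mathcal{L}\phi^{n})+\lambda\big((r^{n})^{2}-C\big)+(1-\lambda)\mathcal{E}_{\mathcal N}[\phi^{n}].$$ Furthermore, if $2r^{n+1}(r^{n+1}-r^{n})\ge\mathcal{E}_{\mathcal N}[\phi^{n+1}]-\mathcal{E}_{\mathcal N}[\phi^{n}]$, then also $$\frac{\mathcal{E}[\phi^{n+1}]-\mathcal{E}[\phi^{n}]}{\tau}\le-(\mu^{n+1},\mathcal{G}\mu^{n+1})\le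 0,\qquad\text{where}\quad \mathcal{E}[\phi^{n}]=\frac12(\phi^{n},\mathcal{L}\phi^{n})+\mathcal{E}_{\mathcal N}[\phi^{n}].$$
   Context: Setting: $(\cdot,\cdot)$ is the $L^2(\Omega)$ inner product on real-valued functions on a domain $\Omega$ (with boundary conditions such that boundary terms in integrations by parts vanish). $\mathcal{L}$ is a linear, symmetric, non-negative operator; $\mathcal{G}$ is a positive linear operator; $\mathcal{E}_{\mathcal N}$ is a bounded nonlinear functional with variational derivative $H(\phi)=\delta\mathcal{E}_{\mathcal N}/\delta\phi$, i.e. $\frac{d}{ds}\mathcal{E}_{\mathcal N}[\phi+s\psi]\big|_{s=0}=(H(\phi),\psi)$; $C$ is a constant such that $\mathcal{E}_{\mathcal N}[\phi]+C>0$ for all $\phi$. $r^n\in\mathbb{R}$ is the numerical approximation at $t^n=n\tau$ of the auxiliary variable $r(t)=\sqrt{\mathcal{E}_{\mathcal N}[\phi(t)]+C}$. *)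

theory Defs
  imports "HOL-Analysis.Analysis"
begin

text \<open>
  Elements of \<open>L\<^sup>2(\<Omega>)\<close> are represented by functions on the ambient Euclidean space, and
  equality in \<open>L\<^sup>2(\<Omega>)\<close> by equality almost everywhere on \<open>\<Omega>\<close>.  Operators and functionals act
  on representatives; they are not required to respect this equality.
\<close>

definition L2_space :: "'a::euclidean_space set \<Rightarrow> ('a \<Rightarrow> real) set" where
  "L2_space \<Omega> = {f. f \<in> borel_measurable (lebesgue_on \<Omega>) \<and>
                     integrable (lebesgue_on \<Omega>) (\<lambda>x. (f x)\<^sup>2)}"

definition L2_inner :: "'a::euclidean_space set \<Rightarrow> ('a \<Rightarrow> real) \<Rightarrow> ('a \<Rightarrow> real) \<Rightarrow> real" where
  "L2_inner \<Omega> f g = (\<integral>x. f x * g x \<partial>(lebesgue_on \<Omega>))"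

text \<open>
  Boundary conditions and regularity are part of the choice of the linear subspace on which
  an operator is defined: operators such as \<open>-\<Delta>\<close> are unbounded on \<open>L\<^sup>2(\<Omega>)\<close>.
\<close>

definition L2_subspace :: "'a::euclidean_space set \<Rightarrow> ('a \<Rightarrow> real) set \<Rightarrow> bool" where
  "L2_subspace \<Omega> V \<longleftrightarrow> V \<subseteq> L2_space \<Omega> \<and> (\<lambda>x. 0) \<in> V \<and>
     (\<forall>f\<in>V. \<forall>g\<in>V. (\<lambda>x. f x + g x) \<in> V) \<and>
     (\<forall>c. \<forall>f\<in>V. (\<lambda>x. c * f x) \<in> V)"

definition linear_operator ::
  "'a::euclidean_space set \<Rightarrow> ('a \<Rightarrow> real) set \<Rightarrow> (('a \<Rightarrow> real) \<Rightarrow> 'a \<Rightarrow> real) \<Rightarrow> bool" where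
  "linear_operator \<Omega> V A \<longleftrightarrow> L2_subspace \<Omega> V \<and> (\<forall>f\<in>V. A f \<in> L2_space \<Omega>) \<and>
     (\<forall>f\<in>V. \<forall>g\<in>V. AE x in lebesgue_on \<Omega>. A (\<lambda>y. f y + g y) x = A f x + A g x) \<and>
     (\<forall>c. \<forall>f\<in>V. AE x in lebesgue_on \<Omega>. A (\<lambda>y. c * f y) x = c * A f x)"

definition symmetric_operator ::
  "'a::euclidean_space set \<Rightarrow> ('a \<Rightarrow> real) set \<Rightarrow> (('a \<Rightarrow> real) \<Rightarrow> 'a \<Rightarrow> real) \<Rightarrow> bool" where
  "symmetric_operator \<Omega> V A \<longleftrightarrow> (\<forall>f\<in>V. \<forall>g\<in>V. L2_inner \<Omega> (A f) g = L2_inner \<Omega> f (A g))"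

text \<open>
  Used both for ``non-negative'' and for ``positive'' operators.  Strict positivity is not
  required, so that \<open>-\<Delta>\<close> with periodic or Neumann conditions, which annihilates the
  constants, is included.
\<close>

definition nonneg_operator ::
  "'a::euclidean_space set \<Rightarrow> ('a \<Rightarrow> real) set \<Rightarrow> (('a \<Rightarrow> real) \<Rightarrow> 'a \<Rightarrow> real) \<Rightarrow> bool" where
  "nonneg_operator \<Omega> V A \<longleftrightarrow> (\<forall>f\<in>V. 0 \<le> L2_inner \<Omega> f (A f))"

definition variational_derivative ::
  "'a::euclidean_space set \<Rightarrow> ('a \<Rightarrow> real) set \<Rightarrow> (('a \<Rightarrow> real) \<Rightarrow> real) \<Rightarrow>
     (('a \<Rightarrow> real) \<Rightarrow> 'a \<Rightarrow> real) \<Rightarrow> bool" where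
  "variational_derivative \<Omega> V E H \<longleftrightarrow> (\<forall>\<phi>\<in>V. H \<phi> \<in> L2_space \<Omega> \<and>
     (\<forall>\<psi>\<in>V. ((\<lambda>s. E (\<lambda>x. \<phi> x + s * \<psi> x)) has_real_derivative L2_inner \<Omega> (H \<phi>) \<psi>) (at 0)))"

text \<open>
  One step of the weighted SAV-BE scheme, from \<open>(\<phi>, r)\<close> to \<open>(\<phi>', \<mu>', r')\<close>.
\<close>

definition sav_be_step ::
  "'a::euclidean_space set \<Rightarrow> (('a \<Rightarrow> real) \<Rightarrow> 'a \<Rightarrow> real) \<Rightarrow> (('a \<Rightarrow> real) \<Rightarrow> 'a \<Rightarrow> real) \<Rightarrow>
   (('a \<Rightarrow> real) \<Rightarrow> real) \<Rightarrow> (('a \<Rightarrow> real) \<Rightarrow> 'a \<Rightarrow> real) \<Rightarrow> real \<Rightarrow> real \<Rightarrow> real \<Rightarrow>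
   ('a \<Rightarrow> real) \<Rightarrow> real \<Rightarrow> ('a \<Rightarrow> real) \<Rightarrow> ('a \<Rightarrow> real) \<Rightarrow> real \<Rightarrow> bool" where
  "sav_be_step \<Omega> L G E H C lam \<tau> \<phi> r \<phi>' \<mu>' r' \<longleftrightarrow>
     (AE x in lebesgue_on \<Omega>. (\<phi>' x - \<phi> x) / \<tau> = - G \<mu>' x) \<and>
     (AE x in lebesgue_on \<Omega>. \<mu>' x = L \<phi>' x + r' / sqrt (E \<phi> + C) * H \<phi> x) \<and>
     2 * lam * r' * ((r' - r) / \<tau>) + (1 - lam) * ((E \<phi>' - E \<phi>) / \<tau>)
       = r' / sqrt (E \<phi> + C) * L2_inner \<Omega> (H \<phi>) (\<lambda>x. (\<phi>' x - \<phi> x) / \<tau>)"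

definition energy ::
  "'a::euclidean_space set \<Rightarrow> (('a \<Rightarrow> real) \<Rightarrow> 'a \<Rightarrow> real) \<Rightarrow> (('a \<Rightarrow> real) \<Rightarrow> real) \<Rightarrow>
   ('a \<Rightarrow> real) \<Rightarrow> real" where
  "energy \<Omega> L E \<phi> = 1/2 * L2_inner \<Omega> \<phi> (L \<phi>) + E \<phi>"

definition modified_energy ::
  "'a::euclidean_space set \<Rightarrow> (('a \<Rightarrow> real) \<Rightarrow> 'a \<Rightarrow> real) \<Rightarrow> (('a \<Rightarrow> real) \<Rightarrow> real) \<Rightarrow>
   real \<Rightarrow> real \<Rightarrow> ('a \<Rightarrow> real) \<Rightarrow> real \<Rightarrow> real" where
  "modified_energy \<Omega> L E C lam \<phi> r =
     1/2 * L2_inner \<Omega> \<phi> (L \<phi>) + lam * (r\<^sup>2 - C) + (1 - lam) * E \<phi>"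

end

theory Submission
  imports Defs
begin

text \<open>
  Write \<open>d = \<phi>' - \<phi>\<close> and \<open>k = r' / sqrt (E \<phi> + C)\<close>.  Pairing \<open>d = - \<tau> G \<mu>'\<close> with \<open>\<mu>'\<close>, and
  then replacing \<open>\<mu>'\<close> by \<open>L \<phi>' + k H \<phi>\<close>, gives
  \<open>- \<tau> (\<mu>', G \<mu>') = (L \<phi>', d) + k (H \<phi>, d)\<close> (\<open>sav_be_dissipation\<close>).  Both terms on the right
  dominate differences of energies.

  The quadratic energy \<open>f \<mapsto> (f, L f) / 2\<close> is convex with gradient \<open>L\<close>, so its increment is at
  most the gradient at the \<^emph>\<open>new\<close> point paired with \<open>d\<close>, that is \<open>(L \<phi>', d)\<close>
  (\<open>quadratic_energy_increment_le\<close>); this is where evaluating \<open>L\<close> at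
  \<open>\<phi>'\<close> in the scheme enters.

  The nonlinear term \<open>k (H \<phi>, d)\<close> need not be compared with \<open>E\<close> by any Taylor expansion: the third
  equation of the scheme makes it equal to \<open>2 lam r' (r' - r) + (1 - lam) (E \<phi>' - E \<phi>)\<close>.  Since
  \<open>2 r' (r' - r) = r'\<^sup>2 - r\<^sup>2 + (r' - r)\<^sup>2\<close>, it dominates the increment of the nonlinear part of the
  modified energy.  If moreover \<open>E \<phi>' - E \<phi> \<le> 2 r' (r' - r)\<close>, then, as a convex combination of
  these two numbers, it dominates \<open>E \<phi>' - E \<phi>\<close>, which gives the decay of the original energy.
  All of this is algebra at a fixed step, with no remainder that a small \<open>\<tau>\<close> would have to absorb.
\<close>

lemma L2_space_measurable: "f \<in> L2_space \<Omega> \<Longrightarrow> f \<in> borel_measurable (lebesgue_on \<Omega>)"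
  by (simp add: L2_space_def)

lemma L2_space_integrable_mult:
  assumes "f \<in> L2_space \<Omega>" "g \<in> L2_space \<Omega>"
  shows "integrable (lebesgue_on \<Omega>) (\<lambda>x. f x * g x)"
proof (rule Bochner_Integration.integrable_bound)
  show "integrable (lebesgue_on \<Omega>) (\<lambda>x. (f x)\<^sup>2 + (g x)\<^sup>2)"
    using assms by (simp add: L2_space_def)
  show "(\<lambda>x. f x * g x) \<in> borel_measurable (lebesgue_on \<Omega>)"
    using assms by (intro borel_measurable_times L2_space_measurable)
  have "\<bar>a * b\<bar> \<le> a\<^sup>2 + b\<^sup>2" for a b :: real
  proof -
    have "2 * (\<bar>a\<bar> * \<bar>b\<bar>) \<le> a\<^sup>2 + b\<^sup>2"
      using sum_squares_bound[of "\<bar>a\<bar>" "\<bar>b\<bar>"] by (simp add: mult.assoc)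
    moreover have "0 \<le> \<bar>a\<bar> * \<bar>b\<bar>"
      by simp
    ultimately show ?thesis
      unfolding abs_mult by linarith
  qed
  then show "AE x in lebesgue_on \<Omega>. norm (f x * g x) \<le> norm ((f x)\<^sup>2 + (g x)\<^sup>2)"
    by simp
qed

lemma L2_inner_commute: "L2_inner \<Omega> f g = L2_inner \<Omega> g f"
  by (simp add: L2_inner_def mult.commute)

lemma L2_inner_linear_combination_right:
  assumes "f \<in> L2_space \<Omega>" "g \<in> L2_space \<Omega>" "h \<in> L2_space \<Omega>"
  shows "L2_inner \<Omega> f (\<lambda>x. a * g x + b * h x) = a * L2_inner \<Omega> f g + b * L2_inner \<Omega> f h"
proof -
  have "L2_inner \<Omega> f (\<lambda>x. a * g x + b * h x)
      = (\<integral>x. a * (f x * g x) + b * (f x * h x) \<partial>(lebesgue_on \<Omega>))"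
    unfolding L2_inner_def by (simp add: algebra_simps)
  also have "\<dots> = a * L2_inner \<Omega> f g + b * L2_inner \<Omega> f h"
    unfolding L2_inner_def using assms by (simp add: L2_space_integrable_mult)
  finally show ?thesis .
qed

lemma L2_inner_diff_right:
  assumes "f \<in> L2_space \<Omega>" "g \<in> L2_space \<Omega>" "h \<in> L2_space \<Omega>"
  shows "L2_inner \<Omega> f (\<lambda>x. g x - h x) = L2_inner \<Omega> f g - L2_inner \<Omega> f h"
  using L2_inner_linear_combination_right[OF assms, of 1 "-1"] by simp

lemma L2_inner_cong_AE_right:
  assumes "f \<in> borel_measurable (lebesgue_on \<Omega>)" "g \<in> borel_measurable (lebesgue_on \<Omega>)"
    and "h \<in> borel_measurable (lebesgue_on \<Omega>)" "AE x in lebesgue_on \<Omega>. g x = h x"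
  shows "L2_inner \<Omega> f g = L2_inner \<Omega> f h"
  unfolding L2_inner_def
proof (rule integral_cong_AE)
  show "AE x in lebesgue_on \<Omega>. f x * g x = f x * h x"
    using assms(4) by eventually_elim simp
qed (use assms in \<open>auto intro: borel_measurable_times\<close>)

lemma L2_subspace_diff:
  assumes "L2_subspace \<Omega> V" "f \<in> V" "g \<in> V"
  shows "(\<lambda>x. f x - g x) \<in> V"
proof -
  have add: "\<forall>f\<in>V. \<forall>g\<in>V. (\<lambda>x. f x + g x) \<in> V"
    and scale: "\<forall>c. \<forall>f\<in>V. (\<lambda>x. c * f x) \<in> V"
    using assms(1) unfolding L2_subspace_def by simp_all
  show ?thesis
    using add[rule_format, OF assms(2) scale[rule_format, OF assms(3), of "-1"]] by simp
qed

lemma linear_operator_diff: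
  assumes lin: "linear_operator \<Omega> V A" and f: "f \<in> V" and g: "g \<in> V"
  shows "AE x in lebesgue_on \<Omega>. A (\<lambda>y. f y - g y) x = A f x - A g x"
proof -
  have add: "\<forall>f\<in>V. \<forall>g\<in>V. AE x in lebesgue_on \<Omega>. A (\<lambda>y. f y + g y) x = A f x + A g x"
    and scale: "\<forall>c. \<forall>f\<in>V. AE x in lebesgue_on \<Omega>. A (\<lambda>y. c * f y) x = c * A f x"
    and sub: "L2_subspace \<Omega> V"
    using lin unfolding linear_operator_def by simp_all
  have "\<forall>c. \<forall>f\<in>V. (\<lambda>x. c * f x) \<in> V"
    using sub unfolding L2_subspace_def by simp
  note ng = this[rule_format, OF g, of "-1"]
  show ?thesis
    using add[rule_format, OF f ng] scale[rule_format, OF g, of "-1"]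
    by eventually_elim simp
qed

text \<open>
  This is convexity of the quadratic energy; the defect between the two sides is exactly
  \<open>(g - f, L (g - f)) / 2\<close>.
\<close>

lemma quadratic_energy_increment_le:
  assumes lin: "linear_operator \<Omega> V L" and sym: "symmetric_operator \<Omega> V L"
    and nonneg: "nonneg_operator \<Omega> V L" and f: "f \<in> V" and g: "g \<in> V"
  shows "1/2 * L2_inner \<Omega> g (L g) - 1/2 * L2_inner \<Omega> f (L f)
    \<le> L2_inner \<Omega> (L g) (\<lambda>x. g x - f x)"
proof -
  let ?d = "\<lambda>x. g x - f x"
  have sub: "L2_subspace \<Omega> V" and L2: "h \<in> L2_space \<Omega>" "L h \<in> L2_space \<Omega>" if "h \<in> V" for h
    using lin that unfolding linear_operator_def L2_subspace_def by auto
  have d: "?d \<in> V"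
    using L2_subspace_diff[OF sub[OF g] g f] .
  have "L2_inner \<Omega> ?d (L ?d) = L2_inner \<Omega> ?d (\<lambda>x. L g x - L f x)"
    using linear_operator_diff[OF lin g f] L2[OF d] L2[OF g] L2[OF f]
    by (intro L2_inner_cong_AE_right borel_measurable_diff L2_space_measurable)
  also have "\<dots> = L2_inner \<Omega> ?d (L g) - L2_inner \<Omega> ?d (L f)"
    using L2 d g f by (intro L2_inner_diff_right) auto
  also have "\<dots> = L2_inner \<Omega> (L g) ?d - L2_inner \<Omega> (L f) ?d"
    by (simp add: L2_inner_commute)
  finally have expand: "L2_inner \<Omega> ?d (L ?d) = L2_inner \<Omega> (L g) ?d - L2_inner \<Omega> (L f) ?d" .
  have "L2_inner \<Omega> (L g) ?d = L2_inner \<Omega> g (L g) - L2_inner \<Omega> (L g) f"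
    using L2 g f by (simp add: L2_inner_diff_right L2_inner_commute)
  moreover have "L2_inner \<Omega> (L f) ?d = L2_inner \<Omega> (L f) g - L2_inner \<Omega> f (L f)"
    using L2 g f by (simp add: L2_inner_diff_right L2_inner_commute)
  moreover have "L2_inner \<Omega> (L g) f = L2_inner \<Omega> (L f) g"
    using sym f g unfolding symmetric_operator_def by (metis L2_inner_commute)
  moreover have "0 \<le> L2_inner \<Omega> ?d (L ?d)"
    using nonneg d unfolding nonneg_operator_def by blast
  ultimately show ?thesis
    using expand by linarith
qed

text \<open>
  Both field equations are tested here: the first with \<open>\<mu>'\<close>, the second with \<open>\<phi>' - \<phi>\<close>, so that
  the mixed term \<open>(\<mu>', \<phi>' - \<phi>)\<close> cancels.  The third equation then removes \<open>H\<close>.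
\<close>

lemma sav_be_dissipation:
  assumes step: "sav_be_step \<Omega> L G E H C lam \<tau> \<phi> r \<phi>' \<mu>' r'" and \<tau>: "0 < \<tau>"
    and L2: "\<mu>' \<in> L2_space \<Omega>"
      "L \<phi>' \<in> L2_space \<Omega>" "G \<mu>' \<in> L2_space \<Omega>" "H \<phi> \<in> L2_space \<Omega>"
      "(\<lambda>x. \<phi>' x - \<phi> x) \<in> L2_space \<Omega>"
  shows "- \<tau> * L2_inner \<Omega> \<mu>' (G \<mu>') = L2_inner \<Omega> (L \<phi>') (\<lambda>x. \<phi>' x - \<phi> x)
    + (2 * lam * r' * (r' - r) + (1 - lam) * (E \<phi>' - E \<phi>))"
proof -
  let ?d = "\<lambda>x. \<phi>' x - \<phi> x" and ?k = "r' / sqrt (E \<phi> + C)"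
  note meas = L2[THEN L2_space_measurable]
  have eq1: "AE x in lebesgue_on \<Omega>. (\<phi>' x - \<phi> x) / \<tau> = - G \<mu>' x"
    and eq2: "AE x in lebesgue_on \<Omega>. \<mu>' x = L \<phi>' x + ?k * H \<phi> x"
    and eq3: "2 * lam * r' * ((r' - r) / \<tau>) + (1 - lam) * ((E \<phi>' - E \<phi>) / \<tau>)
       = ?k * L2_inner \<Omega> (H \<phi>) (\<lambda>x. ?d x / \<tau>)"
    using step unfolding sav_be_step_def by auto
  have "AE x in lebesgue_on \<Omega>. - \<tau> * G \<mu>' x = ?d x"
    using eq1 by eventually_elim (use \<tau> in \<open>simp add: field_simps\<close>)
  then have "L2_inner \<Omega> \<mu>' (\<lambda>x. - \<tau> * G \<mu>' x) = L2_inner \<Omega> \<mu>' ?d"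
    using meas by (intro L2_inner_cong_AE_right) auto
  moreover have "L2_inner \<Omega> \<mu>' (\<lambda>x. - \<tau> * G \<mu>' x) = - \<tau> * L2_inner \<Omega> \<mu>' (G \<mu>')"
    using L2_inner_linear_combination_right[of \<mu>' \<Omega> "G \<mu>'" "G \<mu>'" "- \<tau>" 0] L2 by simp
  moreover have "L2_inner \<Omega> \<mu>' ?d = L2_inner \<Omega> ?d (\<lambda>x. L \<phi>' x + ?k * H \<phi> x)"
    unfolding L2_inner_commute[of \<Omega> \<mu>'] using meas eq2
    by (intro L2_inner_cong_AE_right borel_measurable_add borel_measurable_times
        borel_measurable_const) auto
  moreover have "\<dots> = L2_inner \<Omega> (L \<phi>') ?d + ?k * L2_inner \<Omega> (H \<phi>) ?d"
    using L2_inner_linear_combination_right[of ?d \<Omega> "L \<phi>'" "H \<phi>" 1 ?k] L2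
    by (simp add: L2_inner_commute)
  moreover have "?k * L2_inner \<Omega> (H \<phi>) ?d
      = 2 * lam * r' * (r' - r) + (1 - lam) * (E \<phi>' - E \<phi>)"
  proof -
    have "L2_inner \<Omega> (H \<phi>) (\<lambda>x. ?d x / \<tau>) = L2_inner \<Omega> (H \<phi>) ?d / \<tau>"
      unfolding L2_inner_def by simp
    then have "?k * L2_inner \<Omega> (H \<phi>) ?d = \<tau> * (?k * L2_inner \<Omega> (H \<phi>) (\<lambda>x. ?d x / \<tau>))"
      using \<tau> by simp
    also have "\<dots> = 2 * lam * r' * (r' - r) + (1 - lam) * (E \<phi>' - E \<phi>)"
      unfolding eq3[symmetric] using \<tau> by (simp add: distrib_left)
    finally show ?thesis .
  qed
  ultimately show ?thesis by linarith
qed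

theorem theorem4:
  fixes \<Omega> :: "'a::euclidean_space set"
    and V W :: "('a \<Rightarrow> real) set"
    and L G :: "('a \<Rightarrow> real) \<Rightarrow> 'a \<Rightarrow> real"
    and E :: "('a \<Rightarrow> real) \<Rightarrow> real"
    and H :: "('a \<Rightarrow> real) \<Rightarrow> 'a \<Rightarrow> real"
    and C \<tau> lam r r' :: real
    and \<phi> \<phi>' \<mu>' :: "'a \<Rightarrow> real"
  assumes "open \<Omega>" and "connected \<Omega>" and "\<Omega> \<noteq> {}"
    and "linear_operator \<Omega> V L" and "symmetric_operator \<Omega> V L" and "nonneg_operator \<Omega> V L"
    and "linear_operator \<Omega> W G" and "nonneg_operator \<Omega> W G"
    and "bdd_below (E ` V)"
    and "variational_derivative \<Omega> V E H"
    and "\<forall>f\<in>V. 0 < E f + C"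
    and "0 < \<tau>" and "0 \<le> lam" and "lam \<le> 1"
    and "\<phi> \<in> V" and "\<phi>' \<in> V" and "\<mu>' \<in> W"
    and "sav_be_step \<Omega> L G E H C lam \<tau> \<phi> r \<phi>' \<mu>' r'"
  shows "(modified_energy \<Omega> L E C lam \<phi>' r' - modified_energy \<Omega> L E C lam \<phi> r) / \<tau>
           \<le> - L2_inner \<Omega> \<mu>' (G \<mu>')
         \<and> - L2_inner \<Omega> \<mu>' (G \<mu>') \<le> 0
         \<and> (2 * r' * (r' - r) \<ge> E \<phi>' - E \<phi> \<longrightarrow>
              (energy \<Omega> L E \<phi>' - energy \<Omega> L E \<phi>) / \<tau> \<le> - L2_inner \<Omega> \<mu>' (G \<mu>')
              \<and> - L2_inner \<Omega> \<mu>' (G \<mu>') \<le> 0)"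
proof -
  let ?D = "L2_inner \<Omega> \<mu>' (G \<mu>')" and ?d = "\<lambda>x. \<phi>' x - \<phi> x"
  let ?N = "2 * lam * r' * (r' - r) + (1 - lam) * (E \<phi>' - E \<phi>)"
  have V: "L2_subspace \<Omega> V" and W: "L2_subspace \<Omega> W"
    using \<open>linear_operator \<Omega> V L\<close> \<open>linear_operator \<Omega> W G\<close> unfolding linear_operator_def by auto
  have "?d \<in> V"
    using L2_subspace_diff[OF V \<open>\<phi>' \<in> V\<close> \<open>\<phi> \<in> V\<close>] .
  then have L2: "\<mu>' \<in> L2_space \<Omega>" "?d \<in> L2_space \<Omega>"
    using V W \<open>\<phi> \<in> V\<close> \<open>\<phi>' \<in> V\<close> \<open>\<mu>' \<in> W\<close> unfolding L2_subspace_def by blast+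
  have ops: "L \<phi>' \<in> L2_space \<Omega>" "G \<mu>' \<in> L2_space \<Omega>" "H \<phi> \<in> L2_space \<Omega>"
    using \<open>linear_operator \<Omega> V L\<close> \<open>linear_operator \<Omega> W G\<close> \<open>variational_derivative \<Omega> V E H\<close>
      \<open>\<phi> \<in> V\<close> \<open>\<phi>' \<in> V\<close> \<open>\<mu>' \<in> W\<close>
    unfolding linear_operator_def variational_derivative_def by auto
  have D: "0 \<le> ?D"
    using \<open>nonneg_operator \<Omega> W G\<close> \<open>\<mu>' \<in> W\<close> unfolding nonneg_operator_def by blast
  have "- \<tau> * ?D = L2_inner \<Omega> (L \<phi>') ?d + ?N"
    using sav_be_dissipation[OF \<open>sav_be_step \<Omega> L G E H C lam \<tau> \<phi> r \<phi>' \<mu>' r'\<close> \<open>0 < \<tau>\<close>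
        L2(1) ops L2(2)] .
  moreover have "1/2 * L2_inner \<Omega> \<phi>' (L \<phi>') - 1/2 * L2_inner \<Omega> \<phi> (L \<phi>)
      \<le> L2_inner \<Omega> (L \<phi>') ?d"
    using quadratic_energy_increment_le[OF \<open>linear_operator \<Omega> V L\<close> \<open>symmetric_operator \<Omega> V L\<close>
        \<open>nonneg_operator \<Omega> V L\<close> \<open>\<phi> \<in> V\<close> \<open>\<phi>' \<in> V\<close>] .
  ultimately have balance:
    "1/2 * L2_inner \<Omega> \<phi>' (L \<phi>') - 1/2 * L2_inner \<Omega> \<phi> (L \<phi>) + ?N \<le> - \<tau> * ?D"
    by linarith
  have rate: "x / \<tau> \<le> - ?D" if "x \<le> - \<tau> * ?D" for x
    using that \<open>0 < \<tau>\<close> by (simp add: field_simps)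

  have "?N = lam * (r'\<^sup>2 - r\<^sup>2) + lam * (r' - r)\<^sup>2 + (1 - lam) * (E \<phi>' - E \<phi>)"
    by (simp add: power2_eq_square algebra_simps)
  moreover have "0 \<le> lam * (r' - r)\<^sup>2"
    using \<open>0 \<le> lam\<close> by simp
  ultimately have "lam * (r'\<^sup>2 - r\<^sup>2) + (1 - lam) * (E \<phi>' - E \<phi>) \<le> ?N"
    by linarith
  then have "modified_energy \<Omega> L E C lam \<phi>' r' - modified_energy \<Omega> L E C lam \<phi> r \<le> - \<tau> * ?D"
    using balance unfolding modified_energy_def by (simp add: algebra_simps)
  moreover have "energy \<Omega> L E \<phi>' - energy \<Omega> L E \<phi> \<le> - \<tau> * ?D"
    if "E \<phi>' - E \<phi> \<le> 2 * r' * (r' - r)"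
  proof -
    have "lam * (E \<phi>' - E \<phi>) \<le> lam * (2 * r' * (r' - r))"
      using that \<open>0 \<le> lam\<close> by (rule mult_left_mono)
    then have "E \<phi>' - E \<phi> \<le> ?N"
      by (simp add: algebra_simps)
    then show ?thesis
      using balance unfolding energy_def by linarith
  qed
  ultimately show ?thesis
    using D rate by simp
qed

end
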